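(* Consider $\mathbb{R}$ with density $f(x)=|x|$. Let $0<M_1\le M_2\le M_3$. The solution of the isoperimetric problem for three regions of masses $M_1,M_2,M_3$ is the following condensed configuration of three intervals (one interval per region): the intervals of mass $M_1$ and $M_2$ both have the origin as an endpoint and lie on opposite sides of it, and the interval of mass $M_3$ is adjacent to the interval of mass $M_1$ (on the same side of the origin as it, and farther from the origin). That is, this configuration is isoperimetric: it has the least total perimeter among all configurations of three regions with masses $M_1,M_2,M_3$.
   Context: A density on $\mathbb{R}$ is a nonnegative function $f$. The weighted mass of an interval $[a,b]$ is $\int_a^b f$. A region is a (finite or countably infinite) collection of pairwise disjoint intervals $[a_i,b_i]$; its mass is $\sum_i\int_{a_i}^{b_i} f$. A configuration of $n$ regions consists of $n$ regions on the same line such that any two intervals from different regions are either disjoint or meet at a single endpoint. The total (weighted) perimeter of a configuration is the sum of $f(x)$ over all interval endpoints $x$ of all its regions, where an endpoint shared by two intervals is counted only once. A configuration of $n$ regions with masses $M_1,\dots,M_n$ is isoperimetric (an $n$-bubble) if it has the least total perimeter among all configurations of $n$ regions with these same masses. A condensed configuration of $n$ regions is one consisting of at most $2n$ adjacent intervals (consecutive intervals share an endpoint, so there are no gaps), with at most two intervals per region, and with the origin contained either in the interior of an interval or at an endpoint of at least one interval. *)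

theory Defs
  imports "HOL-Analysis.Analysis"
begin

text \<open>
  An interval \<open>[a, b]\<close> with \<open>a < b\<close> is encoded by the pair \<open>(a, b)\<close>, a region by its set of
  intervals, and a configuration of \<open>n\<close> regions by a list of length \<open>n\<close>. A density is a function
  \<open>real \<Rightarrow> real\<close> that is meant to be nonnegative; masses and perimeters are extended nonnegative
  reals, so that they also make sense for infinite collections of intervals.
\<close>

type_synonym region = "(real \<times> real) set"

definition is_region :: "region \<Rightarrow> bool" where
  "is_region R \<longleftrightarrow> countable R \<and> (\<forall>(a, b) \<in> R. a < b) \<and>
     pairwise (\<lambda>(a, b) (c, d). disjnt {a..b} {c..d}) R"

definition region_mass :: "(real \<Rightarrow> real) \<Rightarrow> region \<Rightarrow> ennreal" where
  "region_mass f R = (\<Sum>\<^sub>\<infinity>(a, b)\<in>R. \<integral>\<^sup>+x\<in>{a..b}. ennreal (f x) \<partial>lborel)"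

definition is_configuration :: "region list \<Rightarrow> bool" where
  "is_configuration C \<longleftrightarrow> (\<forall>R \<in> set C. is_region R) \<and>
     (\<forall>i < length C. \<forall>j < length C. i \<noteq> j \<longrightarrow>
        (\<forall>(a, b) \<in> C ! i. \<forall>(c, d) \<in> C ! j.
           disjnt {a..b} {c..d} \<or>
           (\<exists>x. {a..b} \<inter> {c..d} = {x} \<and> x \<in> {a, b} \<and> x \<in> {c, d})))"

definition has_masses :: "(real \<Rightarrow> real) \<Rightarrow> region list \<Rightarrow> real list \<Rightarrow> bool" where
  "has_masses f C Ms \<longleftrightarrow> map (region_mass f) C = map ennreal Ms"

text \<open>The endpoints form a set, so an endpoint shared by two intervals is counted only once.\<close>

definition endpoints :: "region list \<Rightarrow> real set" where
  "endpoints C = (\<Union>R \<in> set C. \<Union>(a, b) \<in> R. {a, b})"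

definition perimeter :: "(real \<Rightarrow> real) \<Rightarrow> region list \<Rightarrow> ennreal" where
  "perimeter f C = (\<Sum>\<^sub>\<infinity>x\<in>endpoints C. ennreal (f x))"

definition isoperimetric :: "(real \<Rightarrow> real) \<Rightarrow> real list \<Rightarrow> region list \<Rightarrow> bool" where
  "isoperimetric f Ms C \<longleftrightarrow> is_configuration C \<and> has_masses f C Ms \<and>
     (\<forall>D. is_configuration D \<and> has_masses f D Ms \<longrightarrow> perimeter f C \<le> perimeter f D)"

text \<open>
  The increasing list \<open>xs\<close> consists of the successive endpoints, so that the intervals of the
  configuration are exactly those between consecutive entries of \<open>xs\<close>, of which there are
  \<open>length xs - 1\<close>.
\<close>

definition condensed :: "region list \<Rightarrow> bool" where
  "condensed C \<longleftrightarrow> is_configuration C \<and>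
     (\<exists>xs. sorted_wrt (<) xs \<and> length xs - 1 \<le> 2 * length C \<and>
           \<Union> (set C) = set (zip xs (tl xs))) \<and>
     (\<forall>R \<in> set C. finite R \<and> card R \<le> 2) \<and>
     (\<exists>(a, b) \<in> \<Union> (set C). 0 \<in> {a<..<b} \<or> 0 = a \<or> 0 = b)"

text \<open>
  The first and second regions are single intervals with the origin as an endpoint, on opposite
  sides of it, and the third is a single interval adjacent to the first one, on the same side and
  farther from the origin. The two disjuncts are the two orientations, mirror images of each other.
\<close>

definition three_interval_arrangement :: "region list \<Rightarrow> bool" where
  "three_interval_arrangement C \<longleftrightarrow>
     (\<exists>a b c. a < 0 \<and> 0 < b \<and> b < c \<and> C = [{(0, b)}, {(a, 0)}, {(b, c)}]) \<or>
     (\<exists>a b c. 0 < a \<and> b < 0 \<and> c < b \<and> C = [{(b, 0)}, {(0, a)}, {(c, b)}])"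

end

theory Submission
  imports Defs
begin

text \<open>
  The interval \<open>[0, x]\<close> has mass \<open>x\<^sup>2 / 2\<close>, so the claimed minimizer has perimeter
  \<open>sqrt (2 * M1) + sqrt (2 * M2) + sqrt (2 * (M1 + M3))\<close>, and the task is to bound the perimeter of an
  arbitrary configuration below by this number.

  Let \<open>p1 \<ge> p2 \<ge> p3\<close> be the three largest positive endpoints and \<open>- q1 \<le> - q2 \<le> - q3\<close> the three
  smallest negative ones, with \<open>0\<close> in place of those that do not exist. They contribute
  \<open>p1 + p2 + p3 + q1 + q2 + q3\<close> to the perimeter, and this already suffices. A region that is not
  confined to \<open>[- q\<^sub>j, p\<^sub>i]\<close> has a right endpoint among the at most \<open>i - 1\<close> endpoints beyond \<open>p\<^sub>i\<close> or a
  left endpoint among the at most \<open>j - 1\<close> endpoints beyond \<open>- q\<^sub>j\<close>, and two regions cannot share a right endpoint,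
  nor a left one. Hence at least \<open>5 - i - j\<close> regions are confined to \<open>[- q\<^sub>j, p\<^sub>i]\<close>, so that
  \<open>(p\<^sub>i\<^sup>2 + q\<^sub>j\<^sup>2) / 2\<close> is at least the sum of the \<open>5 - i - j\<close> smallest masses
  (\<open>confined_masses_le\<close>).

  What is left is an inequality between real numbers (\<open>three_bubble_inequality_oriented\<close>). It
  expresses that perimeter is a concave function of mass: a sum of square roots decreases when a given
  total is spread out more unevenly. If \<open>q1 \<le> p1\<close>, three endpoints or sums of two endpoints are matched
  with the three terms of the bound, in a way that depends on the position of \<open>q1\<close> relative to
  \<open>sqrt (2 * M1)\<close> and \<open>sqrt (2 * M2)\<close>.

  Infinitely many intervals cause no difficulty: if infinitely many endpoints stay away from the
  origin, the perimeter is infinite, and otherwise endpoints accumulate at most at the origin, so that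
  the largest ones exist.
\<close>

section \<open>Masses of intervals and regions\<close>

lemma infsum_ennreal_ge_finite_sum:
  fixes g :: "'a \<Rightarrow> ennreal"
  assumes "finite T" "T \<subseteq> A"
  shows "sum g T \<le> infsum g A"
  by (subst nonneg_infsum_complete) (use assms in \<open>auto intro: SUP_upper\<close>)

text \<open>
  Single points have no mass, and open intervals have the advantage that those of a configuration are
  pairwise disjoint.
\<close>

lemma interval_mass_eq_open:
  fixes f :: "real \<Rightarrow> real"
  assumes [measurable]: "f \<in> borel_measurable borel"
  shows "(\<integral>\<^sup>+x\<in>{a..b}. ennreal (f x) \<partial>lborel) = emeasure (density lborel f) {a<..<b}"
proof -
  have "AE x in lborel. x \<noteq> a" "AE x in lborel. x \<noteq> b"
    by (rule AE_lborel_singleton)+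
  then have "(\<integral>\<^sup>+x\<in>{a..b}. ennreal (f x) \<partial>lborel) = (\<integral>\<^sup>+x\<in>{a<..<b}. ennreal (f x) \<partial>lborel)"
    by (intro nn_integral_cong_AE, eventually_elim) (auto simp: indicator_def)
  then show ?thesis
    by (simp add: emeasure_density)
qed

text \<open>
  The mass of a region is a sum of masses of intervals; bounding it by the measure of a single set
  lets the masses of several regions be added by additivity of the measure.
\<close>

lemma region_mass_le_interior:
  assumes f [measurable]: "f \<in> borel_measurable borel" and R: "is_region R"
  shows "region_mass f R \<le> emeasure (density lborel f) (\<Union>(a, b)\<in>R. {a<..<b})"
  unfolding region_mass_def
proof (rule infsum_le_finite_sums)
  fix F assume F: "finite F" "F \<subseteq> R"
  let ?I = "\<lambda>(a, b). {a<..<b::real}"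
  have disj: "disjoint_family_on ?I F"
    unfolding disjoint_family_on_def
  proof (intro ballI impI)
    fix I K assume "I \<in> F" "K \<in> F" "I \<noteq> K"
    moreover have "pairwise (\<lambda>(a, b) (c, d). disjnt {a..b} {c..d}) R"
      using R by (simp add: is_region_def)
    ultimately have "(\<lambda>(a, b) (c, d). disjnt {a..b} {c..d}) I K"
      using F(2) by (meson pairwiseD subsetD)
    moreover have "?I I \<subseteq> (\<lambda>(a, b). {a..b}) I" "?I K \<subseteq> (\<lambda>(a, b). {a..b}) K"
      by (auto split: prod.splits)
    ultimately show "?I I \<inter> ?I K = {}"
      by (cases I, cases K) (auto simp: disjnt_def)
  qed
  have "(\<Sum>(a, b)\<in>F. \<integral>\<^sup>+x\<in>{a..b}. ennreal (f x) \<partial>lborel) = (\<Sum>J\<in>F. emeasure (density lborel f) (?I J))"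
    by (rule sum.cong) (auto simp: interval_mass_eq_open)
  also have "\<dots> = emeasure (density lborel f) (\<Union>J\<in>F. ?I J)"
    using F disj by (intro sum_emeasure) auto
  also have "\<dots> \<le> emeasure (density lborel f) (\<Union>J\<in>R. ?I J)"
    using F(2) by (intro emeasure_mono) (blast, simp, intro borel_open open_UN ballI, simp split: prod.splits)
  finally show "(\<Sum>(a, b)\<in>F. \<integral>\<^sup>+x\<in>{a..b}. ennreal (f x) \<partial>lborel)
      \<le> emeasure (density lborel f) (\<Union>(a, b)\<in>R. {a<..<b})" .
qed (auto intro: nonneg_summable_on_complete)

lemma signed_square_has_derivative:
  "((\<lambda>x::real. x * \<bar>x\<bar> / 2) has_real_derivative \<bar>x\<bar>) (at x)"
proof -
  consider "x < 0" | "x = 0" | "x > 0" by linarith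
  then show ?thesis
  proof cases
    case 1
    have "((\<lambda>x::real. - x\<^sup>2 / 2) has_real_derivative \<bar>x\<bar>) (at x)"
      using 1 by (auto intro!: derivative_eq_intros)
    then show ?thesis
      by (rule has_field_derivative_transform_within_open[where S = "{..<0}"])
        (use 1 in \<open>auto simp: power2_eq_square\<close>)
  next
    case 2
    \<comment> \<open>At the origin the sign of the function changes, and the difference quotient is \<open>\<bar>h\<bar> / 2\<close>.\<close>
    have "(\<lambda>h::real. \<bar>h\<bar> / 2) \<midarrow>0\<rightarrow> \<bar>0\<bar> / 2"
      by (intro tendsto_intros) simp
    then have "(\<lambda>h::real. \<bar>h\<bar> / 2) \<midarrow>0\<rightarrow> \<bar>0\<bar>"
      by simp
    then have "(\<lambda>h::real. ((0 + h) * \<bar>0 + h\<bar> / 2 - 0 * \<bar>0\<bar> / 2) / h) \<midarrow>0\<rightarrow> \<bar>0\<bar>"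
      by (rule Lim_transform_eventually) (auto simp: eventually_at_filter)
    then show ?thesis
      unfolding 2 DERIV_def .
  next
    case 3
    have "((\<lambda>x::real. x\<^sup>2 / 2) has_real_derivative \<bar>x\<bar>) (at x)"
      using 3 by (auto intro!: derivative_eq_intros)
    then show ?thesis
      by (rule has_field_derivative_transform_within_open[where S = "{0<..}"])
        (use 3 in \<open>auto simp: power2_eq_square\<close>)
  qed
qed

lemma interval_mass_abs:
  assumes "a \<le> b"
  shows "(\<integral>\<^sup>+x\<in>{a..b}. ennreal \<bar>x\<bar> \<partial>lborel) = ennreal (b * \<bar>b\<bar> / 2 - a * \<bar>a\<bar> / 2)"
  using assms by (intro nn_integral_FTC_Icc)
    (auto intro: has_field_derivative_at_within signed_square_has_derivative)

text \<open>
  Intervals of different regions share at most an endpoint of both.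
\<close>

lemma interiors_disjoint:
  assumes C: "is_configuration C" and "i < length C" "j < length C" "i \<noteq> j"
  shows "(\<Union>(a, b)\<in>C ! i. {a<..<b}) \<inter> (\<Union>(a, b)\<in>C ! j. {a<..<b}) = {}"
proof (rule ccontr)
  assume "\<not> ?thesis"
  then obtain y I K where "I \<in> C ! i" "K \<in> C ! j"
    "y \<in> (case I of (a, b) \<Rightarrow> {a<..<b})" "y \<in> (case K of (a, b) \<Rightarrow> {a<..<b})"
    by blast
  then obtain a b c d where y: "(a, b) \<in> C ! i" "(c, d) \<in> C ! j" "a < y" "y < b" "c < y" "y < d"
    by (cases I, cases K) auto
  have "disjnt {a..b} {c..d} \<or> (\<exists>x. {a..b} \<inter> {c..d} = {x} \<and> x \<in> {a, b} \<and> x \<in> {c, d})"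
    using C[unfolded is_configuration_def, THEN conjunct2, rule_format, OF assms(2-4) y(1)] y(2)
    by auto
  moreover have "y \<in> {a..b} \<inter> {c..d}"
    using y by auto
  ultimately show False
    using y by (auto simp: disjnt_def)
qed

lemma sum_region_mass_confined:
  assumes C: "is_configuration C" and J: "J \<subseteq> {..<length C}" and ab: "0 \<le> a" "0 \<le> b"
    and conf: "\<And>i c d. i \<in> J \<Longrightarrow> (c, d) \<in> C ! i \<Longrightarrow> - b \<le> c \<and> d \<le> a"
  shows "(\<Sum>i\<in>J. region_mass abs (C ! i)) \<le> ennreal ((a\<^sup>2 + b\<^sup>2) / 2)"
proof -
  let ?\<mu> = "density lborel (\<lambda>x::real. ennreal \<bar>x\<bar>)"
  let ?U = "\<lambda>i. \<Union>(c, d)\<in>C ! i. {c<..<d}"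
  have "(\<Sum>i\<in>J. region_mass abs (C ! i)) \<le> (\<Sum>i\<in>J. emeasure ?\<mu> (?U i))"
    using C J by (intro sum_mono region_mass_le_interior) (auto simp: is_configuration_def)
  also have "\<dots> = emeasure ?\<mu> (\<Union>i\<in>J. ?U i)"
  proof (rule sum_emeasure)
    show "?U ` J \<subseteq> sets ?\<mu>"
      by (simp, intro image_subsetI borel_open open_UN ballI) (simp split: prod.splits)
    show "disjoint_family_on ?U J"
      unfolding disjoint_family_on_def
    proof (intro ballI impI)
      fix i j assume "i \<in> J" "j \<in> J" "i \<noteq> j"
      then show "?U i \<inter> ?U j = {}" using J by (intro interiors_disjoint[OF C]) auto
    qed
    show "finite J"
      using J finite_subset by blast
  qed
  also have "\<dots> \<le> emeasure ?\<mu> {-b..a}"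
  proof (rule emeasure_mono)
    have "{c<..<d} \<subseteq> {-b..a}" if "i \<in> J" "(c, d) \<in> C ! i" for i c d
      using conf[OF that] by auto
    then show "(\<Union>i\<in>J. ?U i) \<subseteq> {-b..a}" by blast
  qed simp
  also have "\<dots> = ennreal ((a\<^sup>2 + b\<^sup>2) / 2)"
    using ab interval_mass_abs[of "-b" a] by (simp add: emeasure_density power2_eq_square add_divide_distrib)
  finally show ?thesis .
qed

section \<open>Regions confined to an interval around the origin\<close>

text \<open>
  Two intervals with the same right endpoint, or with the same left endpoint, overlap in their
  interiors. Hence sending a region to one of its right endpoints in \<open>D\<close> is injective, and
  likewise for left endpoints.
\<close>

lemma card_regions_with_shared_endpoint:
  assumes C: "is_configuration C" and D: "finite D"
  shows "card {i. i < length C \<and> (\<exists>(a, b)\<in>C ! i. b \<in> D)} \<le> card D" (is "card ?A \<le> _")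
    and "card {i. i < length C \<and> (\<exists>(a, b)\<in>C ! i. a \<in> D)} \<le> card D" (is "card ?B \<le> _")
proof -
  have overlap: "i = j" if ij: "i < length C" "j < length C" and
    I: "(a, b) \<in> C ! i" "(c, d) \<in> C ! j" and eq: "a = c \<or> b = d" for i j a b c d
  proof (rule ccontr)
    assume "i \<noteq> j"
    have "is_region (C ! i)" "is_region (C ! j)"
      using C ij by (auto simp: is_configuration_def)
    then have "a < b" "c < d"
      using I by (auto simp: is_region_def)
    \<comment> \<open>The midpoint of the intersection of the two intervals, which has positive length.\<close>
    then have y: "(max a c + min b d) / 2 \<in> {a<..<b}" "(max a c + min b d) / 2 \<in> {c<..<d}"
      using eq by auto
    have "(max a c + min b d) / 2 \<in> (\<Union>(a, b)\<in>C ! i. {a<..<b})"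
      "(max a c + min b d) / 2 \<in> (\<Union>(a, b)\<in>C ! j. {a<..<b})"
      by (rule UN_I[OF I(1)], use y in simp, rule UN_I[OF I(2)], use y in simp)
    then show False
      using interiors_disjoint[OF C ij \<open>i \<noteq> j\<close>] by (meson disjoint_iff)
  qed
  define e where "e i = (SOME b. b \<in> D \<and> (\<exists>a. (a, b) \<in> C ! i))" for i
  have e: "e i \<in> D \<and> (\<exists>a. (a, e i) \<in> C ! i)" if i: "i \<in> ?A" for i
  proof -
    from i obtain I where "I \<in> C ! i" "(\<lambda>(a, b). b \<in> D) I" by blast
    then have "snd I \<in> D \<and> (\<exists>a. (a, snd I) \<in> C ! i)" by (cases I) auto
    then show ?thesis unfolding e_def by (rule someI)
  qed
  have "inj_on e ?A"
  proof (rule inj_onI)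
    fix i j assume ij: "i \<in> ?A" "j \<in> ?A" and "e i = e j"
    then obtain a c where "(a, e i) \<in> C ! i" "(c, e i) \<in> C ! j"
      using e[OF ij(1)] e[OF ij(2)] by auto
    then show "i = j" using overlap ij by blast
  qed
  then show "card ?A \<le> card D"
    by (rule card_inj_on_le) (use e D in auto)
  define e' where "e' i = (SOME a. a \<in> D \<and> (\<exists>b. (a, b) \<in> C ! i))" for i
  have e': "e' i \<in> D \<and> (\<exists>b. (e' i, b) \<in> C ! i)" if i: "i \<in> ?B" for i
  proof -
    from i obtain I where "I \<in> C ! i" "(\<lambda>(a, b). a \<in> D) I" by blast
    then have "fst I \<in> D \<and> (\<exists>b. (fst I, b) \<in> C ! i)" by (cases I) auto
    then show ?thesis unfolding e'_def by (rule someI)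
  qed
  have "inj_on e' ?B"
  proof (rule inj_onI)
    fix i j assume ij: "i \<in> ?B" "j \<in> ?B" and "e' i = e' j"
    then obtain b d where "(e' i, b) \<in> C ! i" "(e' i, d) \<in> C ! j"
      using e'[OF ij(1)] e'[OF ij(2)] by auto
    then show "i = j" using overlap ij by blast
  qed
  then show "card ?B \<le> card D"
    by (rule card_inj_on_le) (use e' D in auto)
qed

text \<open>
  The regions in \<open>J\<close> are those with no right endpoint in \<open>D\<close> and no left endpoint in \<open>D'\<close>; every other
  region uses up an element of \<open>D\<close> or of \<open>D'\<close>.
\<close>

lemma many_regions_confined:
  assumes C: "is_configuration C" and ab: "0 \<le> a" "0 \<le> b"
    and D: "finite D" "endpoints C \<inter> {a<..} \<subseteq> D" and D': "finite D'" "endpoints C \<inter> {..<-b} \<subseteq> D'"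
  obtains J where "J \<subseteq> {..<length C}" "length C \<le> card J + card D + card D'"
    "(\<Sum>i\<in>J. region_mass abs (C ! i)) \<le> ennreal ((a\<^sup>2 + b\<^sup>2) / 2)"
proof
  let ?A = "{i. i < length C \<and> (\<exists>(c, d)\<in>C ! i. d \<in> D)}"
  let ?B = "{i. i < length C \<and> (\<exists>(c, d)\<in>C ! i. c \<in> D')}"
  let ?J = "{..<length C} - (?A \<union> ?B)"
  show "?J \<subseteq> {..<length C}" by blast
  have "card {..<length C} \<le> card (?J \<union> (?A \<union> ?B))"
    by (intro card_mono) auto
  also have "\<dots> \<le> card ?J + (card ?A + card ?B)"
    by (meson add_left_mono card_Un_le order_trans)
  finally show "length C \<le> card ?J + card D + card D'"
    using card_regions_with_shared_endpoint[OF C D(1)] card_regions_with_shared_endpoint[OF C D'(1)] by simp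
  show "(\<Sum>i\<in>?J. region_mass abs (C ! i)) \<le> ennreal ((a\<^sup>2 + b\<^sup>2) / 2)"
  proof (rule sum_region_mass_confined[OF C _ ab])
    fix i c d assume i: "i \<in> ?J" and I: "(c, d) \<in> C ! i"
    then have "C ! i \<in> set C" by simp
    then have "c \<in> endpoints C" "d \<in> endpoints C"
      using UN_upper[OF I, of "\<lambda>(a, b). {a, b}"] unfolding endpoints_def by auto
    moreover have "d \<notin> D" "c \<notin> D'" using i I by auto
    ultimately have "d \<notin> {a<..}" "c \<notin> {..<-b}"
      using D(2) D'(2) by blast+
    then show "- b \<le> c \<and> d \<le> a" by simp
  qed blast
qed

section \<open>Confinement for three regions\<close>

lemma smallest_masses_le:
  fixes M1 M2 M3 :: real
  assumes "0 \<le> M1" "M1 \<le> M2" "M2 \<le> M3" and J: "J \<subseteq> {..<3}"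
  shows "card J \<ge> 1 \<Longrightarrow> M1 \<le> (\<Sum>i\<in>J. [M1, M2, M3] ! i)"
    and "card J \<ge> 2 \<Longrightarrow> M1 + M2 \<le> (\<Sum>i\<in>J. [M1, M2, M3] ! i)"
    and "card J \<ge> 3 \<Longrightarrow> M1 + M2 + M3 \<le> (\<Sum>i\<in>J. [M1, M2, M3] ! i)"
proof -
  have "J \<in> Pow {0, 1, 2}" using J by (auto simp: less_Suc_eq numeral_3_eq_3)
  then have cases: "J \<in> {{}, {0}, {1}, {2}, {0, 1}, {0, 2}, {1, 2}, {0, 1, 2}}"
    by (auto simp: Pow_insert)
  show "card J \<ge> 1 \<Longrightarrow> M1 \<le> (\<Sum>i\<in>J. [M1, M2, M3] ! i)"
    and "card J \<ge> 2 \<Longrightarrow> M1 + M2 \<le> (\<Sum>i\<in>J. [M1, M2, M3] ! i)"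
    and "card J \<ge> 3 \<Longrightarrow> M1 + M2 + M3 \<le> (\<Sum>i\<in>J. [M1, M2, M3] ! i)"
    using cases assms(1-3) by auto
qed

text \<open>
  The sets \<open>D\<close> and \<open>D'\<close> will consist of the endpoints beyond \<open>p\<^sub>i\<close> and beyond \<open>- q\<^sub>j\<close>. The masses are
  increasing, so any one, two or three regions have at least the mass of the first one, two or three.
\<close>

lemma confined_masses_le:
  assumes C: "is_configuration C" and M: "has_masses abs C [M1, M2, M3]"
    and ord: "0 \<le> M1" "M1 \<le> M2" "M2 \<le> M3" and ab: "0 \<le> a" "0 \<le> b"
    and D: "finite D" "endpoints C \<inter> {a<..} \<subseteq> D" and D': "finite D'" "endpoints C \<inter> {..<-b} \<subseteq> D'"
  shows "card D + card D' \<le> 2 \<Longrightarrow> M1 \<le> (a\<^sup>2 + b\<^sup>2) / 2"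
    and "card D + card D' \<le> 1 \<Longrightarrow> M1 + M2 \<le> (a\<^sup>2 + b\<^sup>2) / 2"
    and "card D + card D' = 0 \<Longrightarrow> M1 + M2 + M3 \<le> (a\<^sup>2 + b\<^sup>2) / 2"
proof -
  have len: "length C = 3"
    using M by (auto simp: has_masses_def dest: arg_cong[where f = length])
  have mass: "region_mass abs (C ! i) = ennreal ([M1, M2, M3] ! i)" if "i < 3" for i
    using that len M nth_map[of i C "region_mass abs"] nth_map[of i "[M1, M2, M3]" ennreal]
    by (simp add: has_masses_def)
  obtain J where J: "J \<subseteq> {..<3}" "3 \<le> card J + card D + card D'"
    and le: "(\<Sum>i\<in>J. region_mass abs (C ! i)) \<le> ennreal ((a\<^sup>2 + b\<^sup>2) / 2)"
    using many_regions_confined[OF C ab D D'] len by metis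
  have nonneg: "0 \<le> [M1, M2, M3] ! i" if "i \<in> J" for i
  proof -
    have "i = 0 \<or> i = 1 \<or> i = 2" using that J(1) by auto
    then show ?thesis using ord by auto
  qed
  have "(\<Sum>i\<in>J. region_mass abs (C ! i)) = (\<Sum>i\<in>J. ennreal ([M1, M2, M3] ! i))"
    using J(1) mass by (intro sum.cong) auto
  also have "\<dots> = ennreal (\<Sum>i\<in>J. [M1, M2, M3] ! i)"
    using nonneg by (intro sum_ennreal) auto
  finally have "(\<Sum>i\<in>J. [M1, M2, M3] ! i) \<le> (a\<^sup>2 + b\<^sup>2) / 2"
    using le by (simp add: ennreal_le_iff)
  then show "card D + card D' \<le> 2 \<Longrightarrow> M1 \<le> (a\<^sup>2 + b\<^sup>2) / 2"
    and "card D + card D' \<le> 1 \<Longrightarrow> M1 + M2 \<le> (a\<^sup>2 + b\<^sup>2) / 2"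
    and "card D + card D' = 0 \<Longrightarrow> M1 + M2 + M3 \<le> (a\<^sup>2 + b\<^sup>2) / 2"
    using smallest_masses_le[OF ord J(1)] J(2) by linarith+
qed

section \<open>The largest endpoints\<close>

text \<open>
  The next endpoint below \<open>r\<close> on the way down to the origin. The value \<open>0\<close> stands for an endpoint that
  does not exist; it is harmless, because an endpoint at the origin costs nothing.
\<close>

lemma next_endpoint:
  fixes E :: "real set"
  assumes fin: "\<And>e. e > 0 \<Longrightarrow> finite (E \<inter> {e..})" and "0 \<le> r"
  obtains p where "0 \<le> p" "p \<le> r" "p = 0 \<or> p \<in> E \<and> p < r" "E \<inter> {p<..<r} = {}"
proof (cases "E \<inter> {0<..<r} = {}")
  case True
  then show ?thesis using that[of 0] assms(2) by auto
next
  case False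
  then obtain e where e: "e \<in> E" "0 < e" "e < r" by auto
  let ?S = "E \<inter> {e..<r}"
  have S: "finite ?S" "?S \<noteq> {}"
    using fin[OF e(2)] e by (auto elim!: finite_subset[rotated])
  have "Max ?S \<in> ?S" using S by (rule Max_in)
  moreover have "E \<inter> {Max ?S<..<r} = {}"
  proof -
    have "x \<le> Max ?S" if "x \<in> E" "x < r" "e \<le> x" for x
      using S that by (intro Max_ge) auto
    then show ?thesis using \<open>Max ?S \<in> ?S\<close> by force
  qed
  ultimately show ?thesis using that[of "Max ?S"] e by auto
qed

text \<open>
  The set \<open>T\<close> holds the genuine endpoints among \<open>p1\<close>, \<open>p2\<close>, \<open>p3\<close>: the padding zeros, which may
  coincide, are left out, so that the sum over \<open>T\<close> counts each endpoint once.
\<close>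

lemma three_largest_endpoints:
  fixes E :: "real set"
  assumes fin: "\<And>e. e > 0 \<Longrightarrow> finite (E \<inter> {e..})"
  obtains p1 p2 p3 T where "0 \<le> p3" "p3 \<le> p2" "p2 \<le> p1"
    "E \<inter> {p1<..} \<subseteq> {}" "E \<inter> {p2<..} \<subseteq> {p1}" "E \<inter> {p3<..} \<subseteq> {p1, p2}"
    "finite T" "T \<subseteq> E \<inter> {0<..}" "p1 + p2 + p3 = \<Sum>T"
proof -
  have "bdd_above (E \<inter> {1..})"
    using fin[of 1] by (intro bdd_above_finite) simp
  then obtain B where B: "\<And>x. x \<in> E \<Longrightarrow> 1 \<le> x \<Longrightarrow> x \<le> B"
    unfolding bdd_above_def by auto
  \<comment> \<open>A strict upper bound of \<open>E\<close>, from which the descent starts.\<close>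
  define r where "r = max 1 B + 1"
  have r: "0 \<le> r" "\<And>x. x \<in> E \<Longrightarrow> x < r"
    using B unfolding r_def by (auto, force)
  obtain p1 where p1: "0 \<le> p1" "p1 \<le> r" "p1 = 0 \<or> p1 \<in> E \<and> p1 < r" "E \<inter> {p1<..<r} = {}"
    using next_endpoint[OF fin r(1)] by metis
  obtain p2 where p2: "0 \<le> p2" "p2 \<le> p1" "p2 = 0 \<or> p2 \<in> E \<and> p2 < p1" "E \<inter> {p2<..<p1} = {}"
    using next_endpoint[OF fin p1(1)] by metis
  obtain p3 where p3: "0 \<le> p3" "p3 \<le> p2" "p3 = 0 \<or> p3 \<in> E \<and> p3 < p2" "E \<inter> {p3<..<p2} = {}"
    using next_endpoint[OF fin p2(1)] by metis
  show ?thesis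
  proof (rule that[of p3 p2 p1 "{p1, p2, p3} - {0}"])
    show E1: "E \<inter> {p1<..} \<subseteq> {}" using p1(4) r(2) by force
    show E2: "E \<inter> {p2<..} \<subseteq> {p1}" using p2(4) E1 by force
    show "E \<inter> {p3<..} \<subseteq> {p1, p2}" using p3(4) E2 by force
    show "p1 + p2 + p3 = \<Sum>({p1, p2, p3} - {0})"
    proof (cases "p2 = 0")
      case True
      then show ?thesis using p3(1,2) by (cases "p1 = 0") (auto simp: insert_Diff_if)
    next
      case False
      then show ?thesis using p2(1-3) p3(1-3) by (cases "p3 = 0") (auto simp: insert_Diff_if)
    qed
    show "{p1, p2, p3} - {0} \<subseteq> E \<inter> {0<..}" using p1(1,3) p2(1,3) p3(1,3) by auto
  qed (use p1 p2 p3 in auto)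
qed

section \<open>The inequality between endpoints and masses\<close>

lemma le_add_of_sum_squares:
  fixes a b s :: real
  assumes "0 \<le> a" "0 \<le> b" "s\<^sup>2 \<le> a\<^sup>2 + b\<^sup>2"
  shows "s \<le> a + b"
proof (rule power2_le_imp_le)
  have "0 \<le> 2 * a * b" using assms by simp
  then show "s\<^sup>2 \<le> (a + b)\<^sup>2" using assms(3) unfolding power2_sum by linarith
qed (use assms in simp)

text \<open>
  In terms of squares this is concavity of the square root: for a given sum \<open>a\<^sup>2 + b\<^sup>2\<close> with both
  terms at least \<open>m\<^sup>2\<close>, the value \<open>a + b\<close> is smallest when one of the terms is exactly \<open>m\<^sup>2\<close>.
\<close>

lemma add_le_add_of_sum_squares:
  fixes a b m n :: real
  assumes "0 \<le> m" "m \<le> n" "m \<le> a" "m \<le> b" "m\<^sup>2 + n\<^sup>2 \<le> a\<^sup>2 + b\<^sup>2"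
  shows "m + n \<le> a + b"
proof (cases "n \<le> a \<or> n \<le> b")
  case False
  then have "0 < n + a" using assms by auto
  \<comment> \<open>In the factorization of \<open>n\<^sup>2 - a\<^sup>2 \<le> b\<^sup>2 - m\<^sup>2\<close>, the factor \<open>n + a\<close> is at least \<open>b + m\<close>,
    so that the other factors satisfy \<open>n - a \<le> b - m\<close>.\<close>
  have "(n - a) * (n + a) \<le> (b - m) * (b + m)"
    using assms by (simp add: algebra_simps power2_eq_square)
  also have "\<dots> \<le> (b - m) * (n + a)"
    using False assms by (intro mult_left_mono) auto
  finally show ?thesis
    using \<open>0 < n + a\<close> by (auto dest!: mult_right_le_imp_le)
qed (use assms in auto)


text \<open>
  Write \<open>\<alpha>\<close>, \<open>\<beta>\<close>, \<open>\<gamma>\<close> for the distances from the origin at which the claimed minimizer has its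
  endpoints. For \<open>\<beta> \<le> q1\<close> the pair \<open>p1\<close>, \<open>q1\<close> pays for \<open>\<beta> + \<gamma>\<close> and the pair \<open>p2\<close>, \<open>q2\<close> for \<open>\<alpha>\<close>. For
  \<open>q1 < \<beta>\<close> so much mass lies on the positive side that \<open>p1\<close> alone pays for \<open>\<gamma>\<close>; then \<open>p2\<close>, \<open>q1\<close> pay for
  \<open>\<alpha> + \<beta>\<close> if \<open>\<alpha> \<le> q1\<close>, and otherwise \<open>p2\<close> pays for \<open>\<beta>\<close> and \<open>p3\<close>, \<open>q1\<close> for \<open>\<alpha>\<close>. The claimed
  minimizer itself is the case \<open>p1 = \<gamma>\<close>, \<open>p2 = \<alpha>\<close>, \<open>q1 = \<beta>\<close>.
\<close>

lemma three_bubble_inequality_oriented: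
  fixes p1 p2 p3 q1 q2 :: real
  assumes nonneg: "0 \<le> p1" "0 \<le> p2" "0 \<le> p3" "0 \<le> q1" "0 \<le> q2"
    and masses: "0 \<le> M1" "M1 \<le> M2" "M2 \<le> M3"
    and p1q1: "M1 + M2 + M3 \<le> (p1\<^sup>2 + q1\<^sup>2) / 2"
    and p2q1: "M1 + M2 \<le> (p2\<^sup>2 + q1\<^sup>2) / 2"
    and p3q1: "M1 \<le> (p3\<^sup>2 + q1\<^sup>2) / 2"
    and p2q2: "M1 \<le> (p2\<^sup>2 + q2\<^sup>2) / 2"
    and "q1 \<le> p1"
  shows "sqrt (2 * M1) + sqrt (2 * M2) + sqrt (2 * (M1 + M3)) \<le> p1 + p2 + p3 + q1 + q2"
proof -
  define \<alpha> \<beta> \<gamma> where "\<alpha> = sqrt (2 * M1)" and "\<beta> = sqrt (2 * M2)" and "\<gamma> = sqrt (2 * (M1 + M3))"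
  have ord: "0 \<le> \<alpha>" "\<alpha> \<le> \<beta>" "\<beta> \<le> \<gamma>"
    using masses by (auto simp: \<alpha>_def \<beta>_def \<gamma>_def)
  have sq: "\<alpha>\<^sup>2 = 2 * M1" "\<beta>\<^sup>2 = 2 * M2" "\<gamma>\<^sup>2 = 2 * (M1 + M3)"
    using masses by (auto simp: \<alpha>_def \<beta>_def \<gamma>_def)
  consider "\<beta> \<le> q1" | "\<alpha> \<le> q1" "q1 < \<beta>" | "q1 < \<alpha>"
    by linarith
  then have "\<alpha> + \<beta> + \<gamma> \<le> p1 + p2 + p3 + q1 + q2"
  proof cases
    case 1
    have "\<beta> + \<gamma> \<le> p1 + q1"
      by (rule add_le_add_of_sum_squares) (use ord sq 1 p1q1 \<open>q1 \<le> p1\<close> in auto)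
    moreover have "\<alpha> \<le> p2 + q2"
      by (rule le_add_of_sum_squares) (use nonneg sq p2q2 in auto)
    ultimately show ?thesis using nonneg by linarith
  next
    case 2
    then have "q1\<^sup>2 \<le> \<beta>\<^sup>2"
      using nonneg by (intro power_mono) auto
    then have "\<alpha>\<^sup>2 \<le> p2\<^sup>2" "\<gamma>\<^sup>2 \<le> p1\<^sup>2"
      using sq p1q1 p2q1 by auto
    then have "\<alpha> \<le> p2" "\<gamma> \<le> p1"
      using nonneg by (auto intro: power2_le_imp_le)
    moreover have "\<alpha> + \<beta> \<le> p2 + q1"
      by (rule add_le_add_of_sum_squares) (use ord sq 2 p2q1 \<open>\<alpha> \<le> p2\<close> in auto)
    ultimately show ?thesis using nonneg by linarith
  next
    case 3
    then have "q1\<^sup>2 \<le> \<alpha>\<^sup>2"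
      using nonneg by (intro power_mono) auto
    then have "\<beta>\<^sup>2 \<le> p2\<^sup>2" "\<gamma>\<^sup>2 \<le> p1\<^sup>2"
      using sq p1q1 p2q1 masses by auto
    then have "\<beta> \<le> p2" "\<gamma> \<le> p1"
      using nonneg by (auto intro: power2_le_imp_le)
    moreover have "\<alpha> \<le> p3 + q1"
      by (rule le_add_of_sum_squares) (use nonneg sq p3q1 in auto)
    ultimately show ?thesis using nonneg by linarith
  qed
  then show ?thesis by (simp add: \<alpha>_def \<beta>_def \<gamma>_def)
qed

section \<open>The lower bound for the perimeter\<close>

text \<open>
  Only the six extreme endpoints are used; the orientation in which \<open>q1 \<le> p1\<close> fails is its mirror
  image, obtained by exchanging the roles of \<open>p\<close> and \<open>q\<close>.
\<close>

lemma perimeter_lower_bound: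
  assumes C: "is_configuration C" and M: "has_masses abs C [M1, M2, M3]"
    and ord: "0 \<le> M1" "M1 \<le> M2" "M2 \<le> M3"
  shows "ennreal (sqrt (2 * M1) + sqrt (2 * M2) + sqrt (2 * (M1 + M3))) \<le> perimeter abs C"
proof (cases "\<exists>e>0. infinite (endpoints C \<inter> {x. e \<le> \<bar>x\<bar>})")
  case True
  then obtain e where e: "e > 0" "infinite (endpoints C \<inter> {x. e \<le> \<bar>x\<bar>})" by blast
  have "(\<Sum>\<^sub>\<infinity>x\<in>endpoints C \<inter> {x. e \<le> \<bar>x\<bar>}. ennreal \<bar>x\<bar>) = \<infinity>"
    by (rule infsum_superconst_infinite_ennreal[OF _ _ e(2), of "ennreal e"]) (use e in \<open>auto intro: ennreal_leI\<close>)
  moreover have "(\<Sum>\<^sub>\<infinity>x\<in>endpoints C \<inter> {x. e \<le> \<bar>x\<bar>}. ennreal \<bar>x\<bar>) \<le> perimeter abs C"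
    unfolding perimeter_def
    by (rule infsum_mono_neutral) (auto intro: nonneg_summable_on_complete)
  ultimately show ?thesis by (simp add: top_unique)
next
  case False
  let ?E = "endpoints C" and ?E' = "uminus ` endpoints C"
  have fin: "finite (?E \<inter> {x. e \<le> \<bar>x\<bar>})" if "e > 0" for e
    using False that by blast
  have "finite (?E \<inter> {e..})" if "e > 0" for e
    by (rule finite_subset[OF _ fin[OF that]]) auto
  then obtain p1 p2 p3 T where p: "0 \<le> p3" "p3 \<le> p2" "p2 \<le> p1"
    "?E \<inter> {p1<..} \<subseteq> {}" "?E \<inter> {p2<..} \<subseteq> {p1}" "?E \<inter> {p3<..} \<subseteq> {p1, p2}"
    "finite T" "T \<subseteq> ?E \<inter> {0<..}" "p1 + p2 + p3 = \<Sum>T"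
    by (rule three_largest_endpoints)
  have "finite (?E' \<inter> {e..})" if "e > 0" for e
    by (rule finite_subset[OF _ finite_imageI[OF fin[OF that], of uminus]]) auto
  then obtain q1 q2 q3 T' where q: "0 \<le> q3" "q3 \<le> q2" "q2 \<le> q1"
    "?E' \<inter> {q1<..} \<subseteq> {}" "?E' \<inter> {q2<..} \<subseteq> {q1}" "?E' \<inter> {q3<..} \<subseteq> {q1, q2}"
    "finite T'" "T' \<subseteq> ?E' \<inter> {0<..}" "q1 + q2 + q3 = \<Sum>T'"
    by (rule three_largest_endpoints)
  have q': "?E \<inter> {..<-q1} \<subseteq> {}" "?E \<inter> {..<-q2} \<subseteq> {-q1}" "?E \<inter> {..<-q3} \<subseteq> {-q1, -q2}"
    using q(4-6) by (force+)
  have card2: "card {x, y} \<le> 2" for x y :: real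
    by (simp add: card_insert_if)
  note mass = confined_masses_le[OF C M ord]
  have bounds:
    "M1 + M2 + M3 \<le> (p1\<^sup>2 + q1\<^sup>2) / 2"
    "M1 + M2 \<le> (p2\<^sup>2 + q1\<^sup>2) / 2" "M1 + M2 \<le> (p1\<^sup>2 + q2\<^sup>2) / 2"
    "M1 \<le> (p3\<^sup>2 + q1\<^sup>2) / 2" "M1 \<le> (p1\<^sup>2 + q3\<^sup>2) / 2" "M1 \<le> (p2\<^sup>2 + q2\<^sup>2) / 2"
    using mass(3)[OF _ _ _ p(4) _ q'(1)] mass(2)[OF _ _ _ p(5) _ q'(1)] mass(2)[OF _ _ _ p(4) _ q'(2)]
      mass(1)[OF _ _ _ p(6) _ q'(1)] mass(1)[OF _ _ _ p(4) _ q'(3)] mass(1)[OF _ _ _ p(5) _ q'(2)]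
      p(1-3) q(1-3) card2
    by auto
  have "sqrt (2 * M1) + sqrt (2 * M2) + sqrt (2 * (M1 + M3)) \<le> p1 + p2 + p3 + q1 + q2 + q3"
  proof (cases "q1 \<le> p1")
    case True
    then show ?thesis
      using three_bubble_inequality_oriented[of p1 p2 p3 q1 q2 M1 M2 M3] bounds p(1-3) q(1-3) ord by auto
  next
    case False
    then show ?thesis
      using three_bubble_inequality_oriented[of q1 q2 q3 p1 p2 M1 M2 M3] bounds p(1-3) q(1-3) ord
      by (auto simp: add.commute)
  qed
  also have "\<dots> = \<Sum>T + \<Sum>T'" using p(9) q(9) by simp
  also have "\<dots> = (\<Sum>x\<in>T. \<bar>x\<bar>) + (\<Sum>x\<in>uminus ` T'. \<bar>x\<bar>)"
    using p(8) q(8) by (auto simp: sum.reindex intro!: arg_cong2[where f = "(+)"] sum.cong)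
  also have "\<dots> = (\<Sum>x\<in>T \<union> uminus ` T'. \<bar>x\<bar>)"
  proof (rule sum.union_disjoint[symmetric])
    have "0 < x" if "x \<in> T" for x using that p(8) by auto
    moreover have "x < 0" if "x \<in> uminus ` T'" for x using that q(8) by auto
    ultimately show "T \<inter> uminus ` T' = {}" by fastforce
  qed (use p(7) q(7) in auto)
  finally have "ennreal (sqrt (2 * M1) + sqrt (2 * M2) + sqrt (2 * (M1 + M3)))
      \<le> ennreal (\<Sum>x\<in>T \<union> uminus ` T'. \<bar>x\<bar>)"
    by (rule ennreal_leI)
  also have "\<dots> = (\<Sum>x\<in>T \<union> uminus ` T'. ennreal \<bar>x\<bar>)"
    by (intro sum_ennreal[symmetric]) simp
  also have "\<dots> \<le> perimeter abs C"
    unfolding perimeter_def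
  proof (rule infsum_ennreal_ge_finite_sum)
    have "uminus ` T' \<subseteq> endpoints C" using q(8) by auto
    then show "T \<union> uminus ` T' \<subseteq> endpoints C" using p(8) by auto
  qed (use p(7) q(7) in simp)
  finally show ?thesis .
qed

section \<open>The minimizing arrangement\<close>

text \<open>
  In both orientations of the arrangement, the region of mass \<open>M1\<close> is the middle one of three
  consecutive intervals, and it has the origin as an endpoint. The orientations differ in which of the
  outer intervals comes second in the list.
\<close>

lemma three_consecutive_intervals_condensed:
  fixes x y z w :: real
  assumes "x < y" "y < z" "z < w" and origin: "y = 0 \<or> z = 0"
  shows "condensed [{(y, z)}, {(x, y)}, {(z, w)}]" (is "condensed ?C")
    and "condensed [{(y, z)}, {(z, w)}, {(x, y)}]" (is "condensed ?D")
proof -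
  let ?meet = "\<lambda>(a, b) (c, d). disjnt {a..b} {c..d} \<or>
      (\<exists>t. {a..b} \<inter> {c..d} = {t} \<and> t \<in> {a, b} \<and> t \<in> {c, d::real})"
  have "{x..y} \<inter> {y..z} = {y}" "{y..z} \<inter> {x..y} = {y}" "{y..z} \<inter> {z..w} = {z}"
    "{z..w} \<inter> {y..z} = {z}" "disjnt {x..y} {z..w}" "disjnt {z..w} {x..y}"
    using assms by (auto simp: disjnt_def)
  then have meet: "?meet (x, y) (y, z)" "?meet (y, z) (x, y)" "?meet (y, z) (z, w)" "?meet (z, w) (y, z)"
    "?meet (x, y) (z, w)" "?meet (z, w) (x, y)"
    by (simp_all del: Int_atLeastAtMost)
  have regions: "is_region {(x, y)}" "is_region {(y, z)}" "is_region {(z, w)}"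
    using assms by (simp_all add: is_region_def)
  have conf: "is_configuration ?C" "is_configuration ?D"
    unfolding is_configuration_def using regions meet
    by (simp_all add: numeral_3_eq_3 All_less_Suc)
  let ?xs = "[x, y, z, w]"
  have xs: "sorted_wrt (<) ?xs" "length ?xs - 1 \<le> 2 * length ?C" "length ?xs - 1 \<le> 2 * length ?D"
    "\<Union> (set ?C) = set (zip ?xs (tl ?xs))" "\<Union> (set ?D) = set (zip ?xs (tl ?xs))"
    using assms by auto
  show "condensed ?C"
    unfolding condensed_def using origin by (intro conjI exI[of _ ?xs] conf xs) auto
  show "condensed ?D"
    unfolding condensed_def using origin by (intro conjI exI[of _ ?xs] conf xs) auto
qed

lemma region_mass_abs_interval:
  assumes "a \<le> b"
  shows "region_mass abs {(a, b)} = ennreal (b * \<bar>b\<bar> / 2 - a * \<bar>a\<bar> / 2)"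
  using interval_mass_abs[OF assms] by (simp add: region_mass_def)

lemma arrangement_condensed:
  assumes "three_interval_arrangement C"
  shows "condensed C"
  using assms three_consecutive_intervals_condensed unfolding three_interval_arrangement_def
  by (elim disjE exE conjE) simp_all

text \<open>
  The masses determine the endpoints up to reflection, so every arrangement with these masses
  attains the lower bound.
\<close>

lemma arrangement_perimeter:
  assumes C: "three_interval_arrangement C" and M: "has_masses abs C [M1, M2, M3]"
    and "0 < M1" "0 < M2" "0 < M3"
  shows "perimeter abs C = ennreal (sqrt (2 * M1) + sqrt (2 * M2) + sqrt (2 * (M1 + M3)))"
  using C unfolding three_interval_arrangement_def
proof (elim disjE exE conjE)
  fix a b c :: real
  assume ord: "a < 0" "0 < b" "b < c" and C: "C = [{(0, b)}, {(a, 0)}, {(b, c)}]"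
  have "b\<^sup>2 \<le> c\<^sup>2" using ord by (intro power_mono) auto
  then have "b\<^sup>2 / 2 = M1" "a\<^sup>2 / 2 = M2" "c\<^sup>2 / 2 - b\<^sup>2 / 2 = M3"
    using M ord assms(3-5) unfolding C has_masses_def
    by (auto simp: region_mass_abs_interval power2_eq_square)
  then have "sqrt (2 * M1) = b" "sqrt (2 * M2) = - a" "sqrt (2 * (M1 + M3)) = c"
    using ord by (auto intro!: real_sqrt_unique)
  moreover have "endpoints C = {a, 0, b, c}"
    unfolding C endpoints_def by auto
  ultimately show ?thesis
    using ord by (simp add: perimeter_def flip: ennreal_plus)
next
  fix a b c :: real
  assume ord: "0 < a" "b < 0" "c < b" and C: "C = [{(b, 0)}, {(0, a)}, {(c, b)}]"
  have "(-b)\<^sup>2 \<le> (-c)\<^sup>2" using ord by (intro power_mono) auto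
  then have "b\<^sup>2 / 2 = M1" "a\<^sup>2 / 2 = M2" "c\<^sup>2 / 2 - b\<^sup>2 / 2 = M3"
    using M ord assms(3-5) unfolding C has_masses_def
    by (auto simp: region_mass_abs_interval power2_eq_square)
  then have "sqrt (2 * M1) = - b" "sqrt (2 * M2) = a" "sqrt (2 * (M1 + M3)) = - c"
    using ord by (auto intro!: real_sqrt_unique)
  moreover have "endpoints C = {a, 0, b, c}"
    unfolding C endpoints_def by auto
  ultimately show ?thesis
    using ord by (simp add: perimeter_def flip: ennreal_plus)
qed

lemma arrangement_exists:
  assumes "0 < M1" "0 < M2" "0 < M3"
  shows "\<exists>C. three_interval_arrangement C \<and> has_masses abs C [M1, M2, M3]"
proof -
  define a b c where "a = - sqrt (2 * M2)" and "b = sqrt (2 * M1)" and "c = sqrt (2 * (M1 + M3))"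
  have ord: "a < 0" "0 < b" "b < c"
    using assms by (auto simp: a_def b_def c_def)
  have sq: "a * a = 2 * M2" "b * b = 2 * M1" "c * c = 2 * (M1 + M3)"
    using assms by (auto simp: a_def b_def c_def)
  have "has_masses abs [{(0, b)}, {(a, 0)}, {(b, c)}] [M1, M2, M3]"
    using ord sq by (simp add: has_masses_def region_mass_abs_interval add_divide_distrib)
  moreover have "three_interval_arrangement [{(0, b)}, {(a, 0)}, {(b, c)}]"
    using ord unfolding three_interval_arrangement_def by blast
  ultimately show ?thesis by blast
qed

theorem theorem4p7:
  fixes f :: "real \<Rightarrow> real" and M1 M2 M3 :: real
  assumes "f = (\<lambda>x. \<bar>x\<bar>)"
    and "0 < M1" and "M1 \<le> M2" and "M2 \<le> M3"
  shows "(\<exists>C. three_interval_arrangement C \<and> has_masses f C [M1, M2, M3]) \<and>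
         (\<forall>C. three_interval_arrangement C \<and> has_masses f C [M1, M2, M3] \<longrightarrow>
              condensed C \<and> isoperimetric f [M1, M2, M3] C)"
proof (intro conjI allI impI; (elim conjE)?)
  have f: "f = abs" using assms(1) by auto
  have pos: "0 < M2" "0 < M3" using assms(2-4) by auto
  show "\<exists>C. three_interval_arrangement C \<and> has_masses f C [M1, M2, M3]"
    unfolding f using arrangement_exists assms(2) pos .
  fix C assume C: "three_interval_arrangement C" "has_masses f C [M1, M2, M3]"
  show "condensed C"
    using C(1) by (rule arrangement_condensed)
  then have "is_configuration C"
    by (simp add: condensed_def)
  moreover have "perimeter f C \<le> perimeter f D"
    if "is_configuration D" "has_masses f D [M1, M2, M3]" for D
    using arrangement_perimeter[OF C(1)] perimeter_lower_bound[OF that(1), of M1 M2 M3] C(2) that(2) assms(2-4) pos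
    unfolding f by simp
  ultimately show "isoperimetric f [M1, M2, M3] C"
    using C(2) by (simp add: isoperimetric_def)
qed

end
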